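(* Let $A \subset \mathbb{N}^n$ be nonempty and compact, and let $f$ be a real-valued function that is continuously differentiable on an open subset of $\mathbb{R}^n$ containing $A$. Consider the problem of minimizing $f(x)$ over $x \in A$. Then, for any starting point $x^0 \in A$, the projected gradient method with backtracking (Algorithm PGM, described in the context) generates a finite sequence $\{x^j\}_{j=0,\ldots,J} \subseteq A$ and terminates, returning a point $\bar{x} \in A$ that is critical for the problem, i.e. there exists $\eta > 0$ such that $\bar{x} \in \Pi_A(\bar{x} - \eta \nabla f(\bar{x}))$, and that satisfies $f(\bar{x}) \leq f(x^0)$.
   Context: Notation. $\mathbb{N}$ denotes the nonnegative integers (so that $\{0,1\}^n \subset \mathbb{N}^n$), regarded as a subset of $\mathbb{R}$; $\langle\cdot,\cdot\rangle$ and $\|\cdot\|$ are the Euclidean inner product and norm on $\mathbb{R}^n$. The (set-valued) Euclidean projection onto $A$ is $\Pi_A(z) := \arg\min_{x \in A} \|x - z\|^2 \subseteq A$ for $z \in \mathbb{R}^n$. Critical point. A point $\bar{x} \in \mathbb{R}^n$ is critical for the problem of minimizing $f$ over $A$ if there exists $\eta > 0$ such that $\bar{x} \in \Pi_A(\bar{x} - \eta \nabla f(\bar{x}))$ (in particular $\bar{x} \in A$). Algorithm PGM. Input: $x^0 \in A$. Parameters: arbitrary fixed $\alpha, \beta \in (0,1)$ and $\gamma_0 \in (0,\infty)$. For $j = 0, 1, 2, \ldots$ do the following. Set $\gamma_{j+1} \leftarrow \gamma_j$. Then repeat the following inner loop: (1) choose any $x^{j+1} \in \Pi_A(x^j - \gamma_{j+1}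 \nabla f(x^j))$; (2) if $x^{j+1} = x^j$, stop the whole algorithm and return $\bar{x} := x^j$; (3) if at least one of the two conditions $$f(x^{j+1}) \leq f(x^j) - \alpha \frac{\|x^{j+1} - x^j\|^2}{2\gamma_{j+1}} \qquad\text{or}\qquad f(x^{j+1}) \leq f(x^j) - \alpha \langle \nabla f(x^j), x^j - x^{j+1} \rangle$$ holds, exit the inner loop, accept $x^{j+1}$, and proceed to the next $j$; (4) otherwise set $\gamma_{j+1} \leftarrow \beta \gamma_{j+1}$ and go back to (1). The sequence generated by the algorithm is the sequence of the starting point and the accepted iterates. Termination after a finite sequence means that the algorithm stops after finitely many outer iterations, each with finitely many inner (backtracking) steps. *)

theory Defs
  imports "HOL-Analysis.Analysis"
begin

text \<open>
  Meaningful only where \<open>f\<close> is differentiable; see \<open>GDERIV_grad\<close> below.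
\<close>

definition grad :: "('a::euclidean_space \<Rightarrow> real) \<Rightarrow> 'a \<Rightarrow> 'a" where
  "grad f x = (THE D. GDERIV f x :> D)"

lemma grad_eqI:
  fixes f :: "'a::euclidean_space \<Rightarrow> real"
  assumes "GDERIV f x :> D"
  shows "grad f x = D"
  unfolding grad_def
proof (rule the_equality)
  fix E assume "GDERIV f x :> E"
  then have "(\<lambda>h. inner h E) = (\<lambda>h. inner h D)"
    using assms unfolding gderiv_def by (metis has_derivative_unique)
  then show "E = D"
    by (metis vector_eq_ldot)
qed (fact assms)

lemma GDERIV_grad:
  fixes f :: "'a::euclidean_space \<Rightarrow> real"
  assumes "f differentiable (at x)"
  shows "GDERIV f x :> grad f x"
proof -
  obtain f' where f': "(f has_derivative f') (at x)"
    using assms unfolding differentiable_def by blast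
  then have "linear f'"
    by (rule has_derivative_linear)
  have "f' = (\<lambda>h. inner h (adjoint f' 1))"
    using adjoint_works[OF \<open>linear f'\<close>, of _ 1] by auto
  then have "GDERIV f x :> adjoint f' 1"
    using f' unfolding gderiv_def by simp
  then show ?thesis
    by (metis grad_eqI)
qed

text \<open>
  Intended for open \<open>U\<close> only, where \<open>differentiable_on\<close> is differentiability in
  the full space; openness is assumed separately wherever this is used.
\<close>

definition C1_on :: "('a::euclidean_space \<Rightarrow> real) \<Rightarrow> 'a set \<Rightarrow> bool" where
  "C1_on f U \<longleftrightarrow> f differentiable_on U \<and> continuous_on U (grad f)"

definition proj_set :: "'a::euclidean_space set \<Rightarrow> 'a \<Rightarrow> 'a set" where
  "proj_set A z = {x. is_arg_min (\<lambda>x. (norm (x - z))\<^sup>2) (\<lambda>x. x \<in> A) x}"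

definition critical :: "('a::euclidean_space \<Rightarrow> real) \<Rightarrow> 'a set \<Rightarrow> 'a \<Rightarrow> bool" where
  "critical f A x \<longleftrightarrow> (\<exists>\<eta>>0. x \<in> proj_set A (x - \<eta> *\<^sub>R grad f x))"

definition sufficient_decrease ::
  "('a::euclidean_space \<Rightarrow> real) \<Rightarrow> real \<Rightarrow> real \<Rightarrow> 'a \<Rightarrow> 'a \<Rightarrow> bool" where
  "sufficient_decrease f \<alpha> \<gamma> x y \<longleftrightarrow>
     f y \<le> f x - \<alpha> * ((norm (y - x))\<^sup>2 / (2 * \<gamma>)) \<or>
     f y \<le> f x - \<alpha> * inner (grad f x) (x - y)"

text \<open>
  The method is nondeterministic, since the projection is set-valued, so it is rendered as a
  small-step transition system.  The list in a state is the sequence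
  \<open>[x\<^sup>0, \<dots>, x\<^sup>j]\<close> of the starting point and the iterates accepted so far.
  In \<open>Outer xs \<gamma>\<close> the \<open>j\<close>-th outer iteration is about to start with
  \<open>\<gamma> = \<gamma>\<^sub>j\<close>; in \<open>Inner xs \<gamma>\<close> the inner loop is at its
  first instruction with the current trial value \<open>\<gamma>\<close> of \<open>\<gamma>\<^sub>j\<^sub>+\<^sub>1\<close>;
  in \<open>Returned xs x\<close> the algorithm has stopped and returned \<open>x\<close>.
\<close>

datatype 'a pgm_state =
    Outer "'a list" real
  | Inner "'a list" real
  | Returned "'a list" 'a

inductive pgm_step ::
  "('a::euclidean_space \<Rightarrow> real) \<Rightarrow> 'a set \<Rightarrow> real \<Rightarrow> real \<Rightarrow> 'a pgm_state \<Rightarrow> 'a pgm_state \<Rightarrow> bool"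
  for f A \<alpha> \<beta> where
  start: "pgm_step f A \<alpha> \<beta> (Outer xs \<gamma>) (Inner xs \<gamma>)"
| stop: "\<lbrakk>y \<in> proj_set A (last xs - \<gamma> *\<^sub>R grad f (last xs)); y = last xs\<rbrakk>
    \<Longrightarrow> pgm_step f A \<alpha> \<beta> (Inner xs \<gamma>) (Returned xs (last xs))"
| accept: "\<lbrakk>y \<in> proj_set A (last xs - \<gamma> *\<^sub>R grad f (last xs)); y \<noteq> last xs;
     sufficient_decrease f \<alpha> \<gamma> (last xs) y\<rbrakk>
    \<Longrightarrow> pgm_step f A \<alpha> \<beta> (Inner xs \<gamma>) (Outer (xs @ [y]) \<gamma>)"
| backtrack: "\<lbrakk>y \<in> proj_set A (last xs - \<gamma> *\<^sub>R grad f (last xs)); y \<noteq> last xs;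
     \<not> sufficient_decrease f \<alpha> \<gamma> (last xs) y\<rbrakk>
    \<Longrightarrow> pgm_step f A \<alpha> \<beta> (Inner xs \<gamma>) (Inner xs (\<beta> * \<gamma>))"

abbreviation pgm_reachable ::
  "('a::euclidean_space \<Rightarrow> real) \<Rightarrow> 'a set \<Rightarrow> real \<Rightarrow> real \<Rightarrow> real \<Rightarrow> 'a \<Rightarrow> 'a pgm_state \<Rightarrow> bool" where
  "pgm_reachable f A \<alpha> \<beta> \<gamma>0 x0 s \<equiv> (pgm_step f A \<alpha> \<beta>)\<^sup>*\<^sup>* (Outer [x0] \<gamma>0) s"

text \<open>
  Every execution is finite, and an execution can only end by the \<open>stop\<close> rule.  Each
  inner trial is a step of its own, so this covers both loops.
\<close>

definition pgm_terminates ::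
  "('a::euclidean_space \<Rightarrow> real) \<Rightarrow> 'a set \<Rightarrow> real \<Rightarrow> real \<Rightarrow> real \<Rightarrow> 'a \<Rightarrow> bool" where
  "pgm_terminates f A \<alpha> \<beta> \<gamma>0 x0 \<longleftrightarrow>
     \<not> (\<exists>s :: nat \<Rightarrow> 'a pgm_state.
          s 0 = Outer [x0] \<gamma>0 \<and> (\<forall>k. pgm_step f A \<alpha> \<beta> (s k) (s (Suc k)))) \<and>
     (\<forall>s. pgm_reachable f A \<alpha> \<beta> \<gamma>0 x0 s \<longrightarrow>
          (\<exists>s'. pgm_step f A \<alpha> \<beta> s s') \<or> (\<exists>xs x. s = Returned xs x))"

end

theory Submission
  imports Defs
begin

text \<open>
  Distinct lattice points are at distance at least 1, so a compact set of them is finite.  The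
  rest is about a finite set \<open>A\<close>.

  Let \<open>y\<close> be a projection of \<open>x - \<gamma> *\<^sub>R g\<close> onto \<open>A\<close>, where \<open>x \<in> A\<close>.  Comparing \<open>y\<close> with the
  competitor \<open>x\<close> gives \<open>(norm (y - x))\<^sup>2 \<le> 2 * \<gamma> * inner g (x - y)\<close>
  (\<open>proj_set_gradient_step\<close>), and everything follows from this inequality.

  \<^item> If \<open>y \<noteq> x\<close>, the right-hand side is positive, so each of the two tests in
    \<open>sufficient_decrease\<close> implies \<open>f y < f x\<close>.  The objective strictly decreases along accepted
    iterates, and a finite \<open>A\<close> allows only finitely many of them.

  \<^item> By Cauchy-Schwarz, \<open>norm (y - x) \<le> 2 * \<gamma> * norm g\<close>.  The other points of \<open>A\<close> keep a positive
    distance from \<open>x\<close>, so for small \<open>\<gamma>\<close> the only projection is \<open>x\<close> itself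
    (\<open>short_gradient_step_stays\<close>).  Since backtracking shrinks \<open>\<gamma>\<close> geometrically, an inner loop
    that never accepts ends by stopping.

  Both facts together provide a lexicographic termination measure.  On stopping, the current
  step size itself witnesses criticality.
\<close>

section \<open>Projecting a gradient step onto a finite set\<close>

lemma finite_compact_Nats_vec:
  fixes A :: "(real ^ 'n) set"
  assumes "A \<subseteq> {x. \<forall>i. x $ i \<in> \<nat>}" and "compact A"
  shows "finite A"
proof -
  have sep: "x = y" if xy: "x \<in> A" "y \<in> A" "dist y x < 1" for x y
  proof -
    have "x $ i = y $ i" for i
    proof -
      have Ints: "x $ i \<in> \<int>" "y $ i \<in> \<int>"
        using assms(1) xy(1,2) Nats_subset_Ints by blast+
      have "\<bar>y $ i - x $ i\<bar> < 1"
        using component_le_norm_cart[of "y - x" i] xy(3) by (simp add: dist_norm)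
      then show ?thesis
        using Ints_eq_abs_less1[OF Ints(2,1)] by simp
    qed
    then show ?thesis
      by (simp add: vec_eq_iff)
  qed
  show ?thesis
  proof (rule ccontr)
    assume "infinite A"
    then obtain l where "l \<in> A" "l islimpt A"
      using assms(2) unfolding compact_eq_Bolzano_Weierstrass by blast
    then obtain y where "y \<in> A" "y \<noteq> l" "dist y l < 1"
      unfolding islimpt_approachable by (meson zero_less_one)
    then show False
      using sep \<open>l \<in> A\<close> by blast
  qed
qed

lemma proj_set_iff:
  "y \<in> proj_set A z \<longleftrightarrow> y \<in> A \<and> (\<forall>x\<in>A. norm (y - z) \<le> norm (x - z))"
  unfolding proj_set_def is_arg_min_linorder by (auto simp: abs_le_square_iff[symmetric])

lemma proj_set_nonempty:
  assumes "finite A" and "A \<noteq> {}"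
  obtains y where "y \<in> proj_set A z"
  using ex_is_arg_min_if_finite[OF assms] unfolding proj_set_def by blast

text \<open>
  The point \<open>x\<close> competes in the projection at distance \<open>norm (\<gamma> *\<^sub>R g)\<close>; expanding the square of
  \<open>norm (y - x + \<gamma> *\<^sub>R g)\<close> cancels that term.
\<close>

lemma proj_set_gradient_step:
  assumes "x \<in> A" and "y \<in> proj_set A (x - \<gamma> *\<^sub>R g)"
  shows "(norm (y - x))\<^sup>2 \<le> 2 * \<gamma> * inner g (x - y)"
proof -
  have "norm (y - x + \<gamma> *\<^sub>R g) \<le> norm (\<gamma> *\<^sub>R g)"
    using assms unfolding proj_set_iff by (force simp: algebra_simps)
  then have "(norm (y - x + \<gamma> *\<^sub>R g))\<^sup>2 \<le> (norm (\<gamma> *\<^sub>R g))\<^sup>2"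
    by (simp add: power_mono)
  then show ?thesis
    unfolding power2_norm_eq_inner by (simp add: inner_simps inner_commute algebra_simps)
qed

lemma short_gradient_step_stays:
  assumes "finite A" and "x \<in> A"
  obtains \<delta> where "\<delta> > 0" and "\<And>\<gamma>. \<lbrakk>0 < \<gamma>; \<gamma> < \<delta>\<rbrakk> \<Longrightarrow> proj_set A (x - \<gamma> *\<^sub>R g) \<subseteq> {x}"
proof -
  obtain d where d: "d > 0" "\<And>y. \<lbrakk>y \<in> A; y \<noteq> x\<rbrakk> \<Longrightarrow> d \<le> dist x y"
    using finite_set_avoid[OF assms(1), of x] by metis
  \<comment> \<open>The summand 1 keeps the denominator positive when \<open>g = 0\<close>.\<close>
  define \<delta> where "\<delta> = d / (2 * (norm g + 1))"
  have pos: "norm g + 1 > 0"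
    by (smt (verit) norm_ge_zero)
  have "y = x" if \<gamma>: "0 < \<gamma>" "\<gamma> < \<delta>" and y: "y \<in> proj_set A (x - \<gamma> *\<^sub>R g)" for \<gamma> y
  proof (rule ccontr)
    assume "y \<noteq> x"
    have "(norm (y - x))\<^sup>2 \<le> 2 * \<gamma> * (norm g * norm (y - x))"
      using proj_set_gradient_step[OF assms(2) y] norm_cauchy_schwarz[of g "x - y"] \<gamma>(1)
      by (smt (verit) mult_left_mono norm_minus_commute)
    then have "norm (y - x) \<le> 2 * \<gamma> * norm g"
      using \<open>y \<noteq> x\<close> by (simp add: power2_eq_square flip: mult.assoc)
    also have "\<dots> \<le> 2 * \<gamma> * (norm g + 1)"
      using \<gamma>(1) by simp
    also have "\<dots> < d"
      using \<gamma>(2) pos unfolding \<delta>_def by (simp add: field_simps)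
    finally show False
      using d(2)[of y] y \<open>y \<noteq> x\<close> by (simp add: proj_set_iff dist_norm norm_minus_commute)
  qed
  moreover have "\<delta> > 0"
    using d(1) pos unfolding \<delta>_def by simp
  ultimately show thesis
    using that by blast
qed

lemma sufficient_decrease_imp_less:
  assumes "x \<in> A" and "y \<in> proj_set A (x - \<gamma> *\<^sub>R grad f x)" and "y \<noteq> x"
    and "0 < \<gamma>" and "0 < \<alpha>" and "sufficient_decrease f \<alpha> \<gamma> x y"
  shows "f y < f x"
proof -
  have sq: "0 < (norm (y - x))\<^sup>2"
    using assms(3) by simp
  then have "0 < inner (grad f x) (x - y)"
    using proj_set_gradient_step[OF assms(1,2)] assms(4)
    by (smt (verit) mult_nonneg_nonpos)
  then have "0 < \<alpha> * inner (grad f x) (x - y)" "0 < \<alpha> * ((norm (y - x))\<^sup>2 / (2 * \<gamma>))"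
    using sq assms(4,5) by simp_all
  then show ?thesis
    using assms(6) unfolding sufficient_decrease_def by linarith
qed

section \<open>Invariant of the method\<close>

definition iterates_ok :: "('a::euclidean_space \<Rightarrow> real) \<Rightarrow> 'a set \<Rightarrow> 'a \<Rightarrow> 'a list \<Rightarrow> bool" where
  "iterates_ok f A x0 xs \<longleftrightarrow> xs \<noteq> [] \<and> set xs \<subseteq> A \<and> f (last xs) \<le> f x0"

fun pgm_inv :: "('a::euclidean_space \<Rightarrow> real) \<Rightarrow> 'a set \<Rightarrow> 'a \<Rightarrow> 'a pgm_state \<Rightarrow> bool" where
  "pgm_inv f A x0 (Outer xs \<gamma>) \<longleftrightarrow> iterates_ok f A x0 xs \<and> 0 < \<gamma>"
| "pgm_inv f A x0 (Inner xs \<gamma>) \<longleftrightarrow> iterates_ok f A x0 xs \<and> 0 < \<gamma>"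
| "pgm_inv f A x0 (Returned xs x) \<longleftrightarrow> iterates_ok f A x0 xs \<and> x = last xs \<and> critical f A x"

lemma iterates_ok_last_mem:
  "iterates_ok f A x0 xs \<Longrightarrow> last xs \<in> A"
  unfolding iterates_ok_def by auto

lemma pgm_inv_step:
  assumes "pgm_step f A \<alpha> \<beta> s s'" and "pgm_inv f A x0 s" and "0 < \<alpha>" and "0 < \<beta>"
  shows "pgm_inv f A x0 s'"
  using assms(1,2)
proof cases
  case (stop y xs \<gamma>)
  then show ?thesis
    using assms(2) by (auto simp: critical_def)
next
  case (accept y xs \<gamma>)
  then have ok: "iterates_ok f A x0 xs" "0 < \<gamma>"
    using assms(2) by auto
  then have "f y < f (last xs)"
    using sufficient_decrease_imp_less[OF iterates_ok_last_mem] accept assms(3) by blast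
  moreover have "y \<in> A"
    using accept by (simp add: proj_set_iff)
  ultimately show ?thesis
    using ok accept by (auto simp: iterates_ok_def)
qed (use assms in auto)

lemma pgm_inv_reachable:
  assumes "(pgm_step f A \<alpha> \<beta>)\<^sup>*\<^sup>* s s'" and "pgm_inv f A x0 s" and "0 < \<alpha>" and "0 < \<beta>"
  shows "pgm_inv f A x0 s'"
  using assms by (induction rule: rtranclp_induct) (auto intro: pgm_inv_step)

lemma pgm_step_exists:
  assumes "finite A" and "A \<noteq> {}"
  shows "(\<exists>s'. pgm_step f A \<alpha> \<beta> s s') \<or> (\<exists>xs x. s = Returned xs x)"
proof (cases s)
  case (Outer xs \<gamma>)
  then show ?thesis
    using pgm_step.start by blast
next
  case (Inner xs \<gamma>)
  obtain y where "y \<in> proj_set A (last xs - \<gamma> *\<^sub>R grad f (last xs))"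
    using proj_set_nonempty[OF assms] by blast
  then show ?thesis
    unfolding Inner using pgm_step.stop pgm_step.accept pgm_step.backtrack by metis
qed simp

section \<open>Termination measure\<close>

text \<open>
  The three lexicographic components, most significant first.  Accepting lowers the number of
  points of \<open>A\<close> that are better than the current iterate, starting and stopping leave it
  unchanged and lower the phase, and backtracking leaves both unchanged and lowers the number of
  trials that remain until the step size falls below the threshold \<open>\<delta> x\<close> under which the only
  projection is the current iterate \<open>x\<close>.
\<close>

fun better_points :: "('a::euclidean_space \<Rightarrow> real) \<Rightarrow> 'a set \<Rightarrow> 'a pgm_state \<Rightarrow> nat" where
  "better_points f A (Outer xs \<gamma>) = card {a \<in> A. f a < f (last xs)}"
| "better_points f A (Inner xs \<gamma>) = card {a \<in> A. f a < f (last xs)}"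
| "better_points f A (Returned xs x) = card {a \<in> A. f a < f (last xs)}"

fun phase :: "'a pgm_state \<Rightarrow> nat" where
  "phase (Outer xs \<gamma>) = 2"
| "phase (Inner xs \<gamma>) = 1"
| "phase (Returned xs x) = 0"

definition trials_below :: "real \<Rightarrow> real \<Rightarrow> real \<Rightarrow> nat" where
  "trials_below \<beta> d \<gamma> = (LEAST k. \<beta> ^ k * \<gamma> < d)"

fun trials_left :: "('a \<Rightarrow> real) \<Rightarrow> real \<Rightarrow> 'a pgm_state \<Rightarrow> nat" where
  "trials_left \<delta> \<beta> (Inner xs \<gamma>) = trials_below \<beta> (\<delta> (last xs)) \<gamma>"
| "trials_left \<delta> \<beta> _ = 0"

lemma trials_below_decreases:
  assumes "0 < \<beta>" and "\<beta> < 1" and "0 < d" and "0 < \<gamma>" and "d \<le> \<gamma>"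
  shows "trials_below \<beta> d (\<beta> * \<gamma>) < trials_below \<beta> d \<gamma>"
proof -
  obtain k where "\<beta> ^ k < d / \<gamma>"
    using real_arch_pow_inv[of "d / \<gamma>" \<beta>] assms by auto
  then have "\<beta> ^ k * \<gamma> < d"
    using assms(4) by (simp add: field_simps)
  then have least: "\<beta> ^ trials_below \<beta> d \<gamma> * \<gamma> < d"
    unfolding trials_below_def by (rule LeastI)
  moreover have "trials_below \<beta> d \<gamma> \<noteq> 0"
  proof
    assume "trials_below \<beta> d \<gamma> = 0"
    then show False
      using least assms(5) by simp
  qed
  then obtain m where m: "trials_below \<beta> d \<gamma> = Suc m"
    using not0_implies_Suc by blast
  ultimately have "\<beta> ^ m * (\<beta> * \<gamma>) < d"
    by (simp add: mult_ac)
  then have "trials_below \<beta> d (\<beta> * \<gamma>) \<le> m"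
    unfolding trials_below_def by (rule Least_le)
  then show ?thesis
    using m by simp
qed

lemma pgm_step_decreases_measure:
  assumes "pgm_step f A \<alpha> \<beta> s s'" and "pgm_inv f A x0 s" and "finite A"
    and "0 < \<alpha>" and "0 < \<beta>" and "\<beta> < 1"
    and \<delta>: "\<And>x. x \<in> A \<Longrightarrow> 0 < \<delta> x"
      "\<And>x \<gamma>. \<lbrakk>x \<in> A; 0 < \<gamma>; \<gamma> < \<delta> x\<rbrakk> \<Longrightarrow> proj_set A (x - \<gamma> *\<^sub>R grad f x) \<subseteq> {x}"
  shows "(s', s) \<in> measures [better_points f A, phase, trials_left \<delta> \<beta>]"
  using assms(1)
proof cases
  case (accept y xs \<gamma>)
  then have x: "last xs \<in> A" and "0 < \<gamma>"
    using assms(2) iterates_ok_last_mem by auto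
  then have less: "f y < f (last xs)"
    using sufficient_decrease_imp_less accept assms(4) by blast
  have "y \<in> A"
    using accept by (simp add: proj_set_iff)
  \<comment> \<open>The accepted point itself is no longer counted.\<close>
  then have "{a \<in> A. f a < f y} \<subset> {a \<in> A. f a < f (last xs)}"
    using less by force
  then have "card {a \<in> A. f a < f y} < card {a \<in> A. f a < f (last xs)}"
    using assms(3) by (intro psubset_card_mono) auto
  then show ?thesis
    using accept by simp
next
  case (backtrack y xs \<gamma>)
  then have x: "last xs \<in> A" and "0 < \<gamma>"
    using assms(2) iterates_ok_last_mem by auto
  then have "\<delta> (last xs) \<le> \<gamma>"
    using \<delta>(2) backtrack by (meson not_le singletonD subsetD)
  then show ?thesis
    using trials_below_decreases[OF assms(5,6) \<delta>(1)] x \<open>0 < \<gamma>\<close> backtrack by simp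
qed auto

section \<open>Termination at a critical point\<close>

theorem pgm_terminates_finite:
  fixes A :: "'a::euclidean_space set"
  assumes "finite A" and "A \<noteq> {}" and "0 < \<alpha>" and "0 < \<beta>" and "\<beta> < 1" and "0 < \<gamma>0" and "x0 \<in> A"
  shows "pgm_terminates f A \<alpha> \<beta> \<gamma>0 x0"
proof -
  have "\<exists>d>0. \<forall>\<gamma>. 0 < \<gamma> \<and> \<gamma> < d \<longrightarrow> proj_set A (x - \<gamma> *\<^sub>R grad f x) \<subseteq> {x}" if "x \<in> A" for x
    using short_gradient_step_stays[OF assms(1) that] by metis
  then obtain \<delta> where \<delta>: "\<And>x. x \<in> A \<Longrightarrow> 0 < \<delta> x"
      "\<And>x \<gamma>. \<lbrakk>x \<in> A; 0 < \<gamma>; \<gamma> < \<delta> x\<rbrakk> \<Longrightarrow> proj_set A (x - \<gamma> *\<^sub>R grad f x) \<subseteq> {x}"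
    by metis
  have False if s0: "s 0 = Outer [x0] \<gamma>0" and step: "\<And>k. pgm_step f A \<alpha> \<beta> (s k) (s (Suc k))" for s
  proof -
    have inv: "pgm_inv f A x0 (s k)" for k
    proof (induction k)
      case 0
      then show ?case
        using assms s0 by (simp add: iterates_ok_def)
    next
      case (Suc k)
      then show ?case
        using pgm_inv_step[OF step] assms by blast
    qed
    have "(s (Suc k), s k) \<in> measures [better_points f A, phase, trials_left \<delta> \<beta>]" for k
      using pgm_step_decreases_measure[OF step inv] assms \<delta> by blast
    then show False
      using wf_measures wf_iff_no_infinite_down_chain by blast
  qed
  then show ?thesis
    unfolding pgm_terminates_def using pgm_step_exists[OF assms(1,2)] by blast
qed

theorem theorem2p1:
  fixes A U :: "(real ^ 'n) set" and f :: "real ^ 'n \<Rightarrow> real"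
    and \<alpha> \<beta> \<gamma>0 :: real and x0 :: "real ^ 'n"
  assumes "A \<subseteq> {x. \<forall>i. x $ i \<in> \<nat>}" and "A \<noteq> {}" and "compact A"
    and "open U" and "A \<subseteq> U" and "C1_on f U"
    and "0 < \<alpha>" and "\<alpha> < 1" and "0 < \<beta>" and "\<beta> < 1" and "0 < \<gamma>0"
    and "x0 \<in> A"
  shows "pgm_terminates f A \<alpha> \<beta> \<gamma>0 x0 \<and>
    (\<forall>xs xbar. pgm_reachable f A \<alpha> \<beta> \<gamma>0 x0 (Returned xs xbar) \<longrightarrow>
       set xs \<subseteq> A \<and> xbar \<in> A \<and> critical f A xbar \<and> f xbar \<le> f x0)"
proof (intro conjI[of "pgm_terminates f A \<alpha> \<beta> \<gamma>0 x0"] allI impI)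
  show "pgm_terminates f A \<alpha> \<beta> \<gamma>0 x0"
    using pgm_terminates_finite finite_compact_Nats_vec assms by blast
next
  fix xs xbar
  assume "pgm_reachable f A \<alpha> \<beta> \<gamma>0 x0 (Returned xs xbar)"
  moreover have "pgm_inv f A x0 (Outer [x0] \<gamma>0)"
    using assms by (simp add: iterates_ok_def)
  ultimately have "pgm_inv f A x0 (Returned xs xbar)"
    using pgm_inv_reachable assms by blast
  then show "set xs \<subseteq> A \<and> xbar \<in> A \<and> critical f A xbar \<and> f xbar \<le> f x0"
    using iterates_ok_last_mem by (auto simp: iterates_ok_def)
qed

end
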